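(* Let $G$ be a simple connected graph of order $n$ (that is, $|V(G)|=n$). Then $\operatorname{edim}(G) \geq n-2$ if and only if for every triple of distinct vertices from $V(G)$ there exists an ordering $v_1, v_2, v_3$ of the triple such that at least one of the following holds: (1) $v_3$ is adjacent to both $v_1$ and $v_2$, and all non-mutual neighbors of $v_1, v_2$ are adjacent to $v_3$; or (2) for some $u \in V(G)\setminus\{v_1, v_2, v_3\}$: $u$ is adjacent to both $v_1$ and $v_2$; all non-mutual neighbors of $v_1, v_2$ in $V(G)\setminus\{v_1, v_2, v_3\}$, other than $u$ itself, are adjacent to $u$; and any $x \in V(G)\setminus\{v_1, v_2, v_3\}$ that satisfies $d(x, v_2) > d(x, v_1) = 2$ or $d(x, v_1) > d(x, v_2) = 2$ also satisfies $d(x, u) \leq 2$.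
   Context: All graphs are simple and connected. For vertices $u,v$ of a graph $G$, $d(u,v)$ is their distance in $G$. For an edge $e=\{x,y\}$ and a vertex $v$, let $d(e,v)=\min(d(x,v),d(y,v))$. A set $S\subset V(G)$ is a resolving set for the edges of $G$ if no two distinct edges $e,f$ satisfy $d(e,s)=d(f,s)$ for all $s\in S$. The edge metric dimension $\operatorname{edim}(G)$ is the minimum size of a resolving set for the edges of $G$. A vertex $x$ is a non-mutual neighbor of vertices $u,v$ if $x$ is adjacent to $u$ or $v$, but not both. *)

theory Defs
  imports "Graph_Theory.Graph_Theory"
begin

text \<open>
  A finite simple graph is a \<open>graph\<close> in the sense of the library: a finite, loop-free,
  symmetric digraph without parallel arcs. The two arcs between adjacent vertices
  \<open>u\<close> and \<open>v\<close> represent the single undirected edge \<open>{u, v}\<close>.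
\<close>

definition edges :: "('a, 'b) pre_digraph \<Rightarrow> 'a set set" where
  "edges G = {{u, v} | u v. u \<rightarrow>\<^bsub>G\<^esub> v}"

text \<open>The length of a shortest walk, i.e. the library's weighted distance with unit weights.\<close>

definition vdist :: "('a, 'b) pre_digraph \<Rightarrow> 'a \<Rightarrow> 'a \<Rightarrow> ereal" where
  "vdist G u v = wf_digraph.\<mu> G (\<lambda>_. 1) u v"

definition edist :: "('a, 'b) pre_digraph \<Rightarrow> 'a set \<Rightarrow> 'a \<Rightarrow> ereal" where
  "edist G e v = Min ((\<lambda>x. vdist G x v) ` e)"

definition edge_resolving :: "('a, 'b) pre_digraph \<Rightarrow> 'a set \<Rightarrow> bool" where
  "edge_resolving G S \<longleftrightarrow> S \<subseteq> verts G \<and>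
     \<not> (\<exists>e \<in> edges G. \<exists>f \<in> edges G. e \<noteq> f \<and> (\<forall>s \<in> S. edist G e s = edist G f s))"

definition edim :: "('a, 'b) pre_digraph \<Rightarrow> nat" where
  "edim G = (LEAST k. \<exists>S. edge_resolving G S \<and> card S = k)"

definition non_mutual_neighbor :: "('a, 'b) pre_digraph \<Rightarrow> 'a \<Rightarrow> 'a \<Rightarrow> 'a \<Rightarrow> bool" where
  "non_mutual_neighbor G u v x \<longleftrightarrow>
     (x \<rightarrow>\<^bsub>G\<^esub> u \<or> x \<rightarrow>\<^bsub>G\<^esub> v) \<and> \<not> (x \<rightarrow>\<^bsub>G\<^esub> u \<and> x \<rightarrow>\<^bsub>G\<^esub> v)"

end

theory Submission
  imports Defs
begin

text \<open>
  Supersets of resolving sets resolve, so \<open>edim G \<ge> n - 2\<close> says that no set \<open>verts G - T\<close> with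
  \<open>card T = 3\<close> is resolving (\<open>edim_ge_iff\<close>). It remains to see when the complement of a triple \<open>T\<close>
  fails to distinguish two edges \<open>e\<close> and \<open>f\<close>.

  A vertex has distance \<open>0\<close> from exactly the edges that contain it. Hence two undistinguished edges
  agree outside \<open>T\<close>, and since \<open>T\<close> has only three elements they share a vertex:
  \<open>e = {a, c}\<close> and \<open>f = {b, c}\<close> with \<open>a, b \<in> T\<close> (\<open>not_resolving_iff\<close>). The two alternatives of the
  theorem are the cases \<open>c \<in> T\<close>, with \<open>c = v3\<close>, and \<open>c \<notin> T\<close>, with \<open>c = u\<close>. The conditions of
  the theorem say that vertices at distance at most \<open>1\<close> or \<open>2\<close> do not separate the two edges,
  so they are necessary. For sufficiency, suppose that a vertex \<open>s\<close> is closer to \<open>a\<close> than to \<open>b\<close>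
  and \<open>c\<close>. On a shortest path from \<open>s\<close> to \<open>a\<close> the vertex \<open>x\<close> before \<open>a\<close> is adjacent neither to
  \<open>b\<close> nor to \<open>c\<close> (\<open>private_predecessor\<close>), so \<open>x\<close> violates the condition on non-mutual neighbors.
  The only escape is that this condition does not speak about \<open>x\<close>, which happens when \<open>c \<notin> T\<close>
  and \<open>x\<close> is the third vertex of \<open>T\<close>. Then the vertex before \<open>x\<close> lies outside \<open>T\<close>, at distance
  \<open>2\<close> from \<open>a\<close>, and it violates the distance-two condition.
\<close>

section \<open>Distances in connected graphs\<close>

locale connected_graph = graph G for G :: "('a, 'b) pre_digraph" (structure) +
  assumes conn: "Digraph_Component.connected G"
begin

text \<open>
  The distance as a natural number, on which linear arithmetic works without infinities and
  coercions.
\<close>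
definition hops :: "'a \<Rightarrow> 'a \<Rightarrow> nat" where
  "hops u v = (LEAST k. \<exists>p. awalk u p v \<and> length p = k)"

lemma hops_le_length: "awalk u p v \<Longrightarrow> hops u v \<le> length p"
  unfolding hops_def by (rule Least_le) blast

lemma shortest_awalk:
  assumes "u \<in> verts G" "v \<in> verts G"
  obtains p where "awalk u p v" "length p = hops u v"
proof -
  have "u \<rightarrow>\<^sup>*\<^bsub>mk_symmetric G\<^esub> v"
    using conn assms unfolding connected_def strongly_connected_def by simp
  then have "u \<rightarrow>\<^sup>* v"
    using reachable_mk_symmetric_eq[OF sym_arcs] by blast
  then obtain p where "awalk u p v"
    by (auto simp: reachable_awalk)
  then have "\<exists>k p. awalk u p v \<and> length p = k" by blast
  then have "\<exists>p. awalk u p v \<and> length p = hops u v"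
    unfolding hops_def by (rule LeastI_ex)
  then show thesis using that by blast
qed

lemma vdist_eq_hops:
  assumes "u \<in> verts G" "v \<in> verts G"
  shows "vdist G u v = ereal (real (hops u v))"
proof -
  have cost: "awalk_cost (\<lambda>_. 1) p = real (length p)" for p :: "'b list"
    by (induction p) auto
  obtain q where q: "awalk u q v" "length q = hops u v"
    by (rule shortest_awalk[OF assms])
  have "(INF p\<in>{p. awalk u p v}. ereal (awalk_cost (\<lambda>_. 1) p)) = ereal (real (hops u v))"
  proof (rule INF_eqI)
    show "ereal (real (hops u v)) \<le> ereal (awalk_cost (\<lambda>_. 1) p)" if "p \<in> {p. awalk u p v}" for p
      using that hops_le_length by (simp add: cost)
    show "y \<le> ereal (real (hops u v))"
      if "\<And>p. p \<in> {p. awalk u p v} \<Longrightarrow> y \<le> ereal (awalk_cost (\<lambda>_. 1) p)" for y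
      using that[of q] q by (simp add: cost)
  qed
  then show ?thesis unfolding vdist_def \<mu>_def .
qed

lemma hops_triangle:
  assumes "u \<in> verts G" "v \<in> verts G" "w \<in> verts G"
  shows "hops u w \<le> hops u v + hops v w"
proof -
  obtain p where p: "awalk u p v" "length p = hops u v"
    using assms by (blast intro: shortest_awalk)
  obtain q where q: "awalk v q w" "length q = hops v w"
    using assms by (blast intro: shortest_awalk)
  have "awalk u (p @ q) w" using p q by (blast intro: awalk_appendI)
  from hops_le_length[OF this] show ?thesis using p q by simp
qed

lemma hops_eq_0_iff:
  assumes "u \<in> verts G" "v \<in> verts G"
  shows "hops u v = 0 \<longleftrightarrow> u = v"
proof
  assume "hops u v = 0"
  then obtain p where "awalk u p v" "p = []"
    using shortest_awalk[OF assms] by (metis length_0_conv)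
  then show "u = v" by (simp add: awalk_Nil_iff)
next
  assume "u = v"
  then have "awalk u [] v" using assms by (simp add: awalk_Nil_iff)
  from hops_le_length[OF this] show "hops u v = 0" by simp
qed

lemma hops_adj_le: "u \<rightarrow> v \<Longrightarrow> hops u v \<le> 1"
proof -
  assume "u \<rightarrow> v"
  then obtain e where "e \<in> arcs G" "tail G e = u" "head G e = v"
    by (auto simp: arcs_ends_conv)
  then have "awalk u [e] v" by (auto simp: awalk_simps)
  from hops_le_length[OF this] show ?thesis by simp
qed

lemma hops_step:
  assumes "s \<in> verts G" "x \<rightarrow> v"
  shows "hops s v \<le> Suc (hops s x)"
  using hops_triangle[of s x v] hops_adj_le[of x v] adj_in_verts[OF assms(2)] assms by simp

lemma predecessor:
  assumes "s \<in> verts G" "v \<in> verts G" "s \<noteq> v"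
  obtains x where "x \<in> verts G" "x \<rightarrow> v" "hops s v = Suc (hops s x)"
proof -
  obtain p where p: "awalk s p v" "length p = hops s v"
    using assms by (blast intro: shortest_awalk)
  have "p \<noteq> []" using p(1) assms(3) by (auto simp: awalk_Nil_iff)
  then obtain q e where qe: "p = q @ [e]" by (metis append_butlast_last_id)
  then have q: "awalk s q (tail G e)" and e: "e \<in> arcs G" "head G e = v"
    using p(1) by (auto simp: awalk_simps)
  then have x: "tail G e \<rightarrow> v" by (auto simp: arcs_ends_conv)
  have "hops s v = Suc (hops s (tail G e))"
    using hops_le_length[OF q] p(2) qe hops_step[OF assms(1) x] by simp
  then show thesis using that[of "tail G e"] x e by simp
qed

lemma hops_eq_1_iff:
  assumes "u \<in> verts G" "v \<in> verts G" "u \<noteq> v"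
  shows "hops u v = 1 \<longleftrightarrow> u \<rightarrow> v"
proof
  assume "hops u v = 1"
  then obtain x where "x \<in> verts G" "x \<rightarrow> v" "hops u x = 0"
    using predecessor[OF assms] by auto
  then show "u \<rightarrow> v" using hops_eq_0_iff assms by auto
next
  assume "u \<rightarrow> v"
  then show "hops u v = 1"
    using hops_adj_le[of u v] hops_eq_0_iff[OF assms(1,2)] assms(3) by simp
qed

lemma adj_sym: "u \<rightarrow> v \<Longrightarrow> v \<rightarrow> u"
  by (rule arcs_ends_symmetric[OF sym_arcs])

text \<open>
  Arcs can be reversed one at a time, so induction on the distance avoids reversing whole walks.
\<close>
lemma hops_le_sym:
  assumes "u \<in> verts G" "v \<in> verts G"
  shows "hops u v \<le> hops v u"
  using assms(1)
proof (induction "hops v u" arbitrary: u)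
  case 0
  then show ?case using hops_eq_0_iff assms(2) by simp
next
  case (Suc k)
  then have "v \<noteq> u" using hops_eq_0_iff[of v u] assms(2) by auto
  then obtain x where x: "x \<in> verts G" "x \<rightarrow> u" "hops v u = Suc (hops v x)"
    using predecessor[OF assms(2) Suc.prems] by blast
  then have "hops x v \<le> hops v x" using Suc.hyps by simp
  moreover have "hops u x \<le> 1" using hops_adj_le[OF adj_sym[OF x(2)]] .
  ultimately show ?case
    using hops_triangle[of u x v] x Suc.prems assms(2) by simp
qed

lemma hops_sym: "u \<in> verts G \<Longrightarrow> v \<in> verts G \<Longrightarrow> hops u v = hops v u"
  by (simp add: hops_le_sym le_antisym)

lemma edist_pair:
  assumes "x \<in> verts G" "y \<in> verts G" "s \<in> verts G"
  shows "edist G {x, y} s = ereal (real (min (hops s x) (hops s y)))"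
  using assms by (simp add: edist_def vdist_eq_hops hops_sym min_def)

section \<open>Separating two edges with a common vertex\<close>

text \<open>
  Only a vertex that \<open>a\<close> has for itself can be the last step of a shortest path from \<open>s\<close> to \<open>a\<close>,
  because a neighbor of \<open>b\<close> or \<open>c\<close> in that position would bring \<open>s\<close> as close to \<open>b\<close> or \<open>c\<close>.
\<close>
lemma private_predecessor:
  assumes "s \<in> verts G" "a \<in> verts G" "s \<noteq> a"
    and "hops s a < hops s b" "hops s a < hops s c"
  obtains x where "x \<in> verts G" "x \<rightarrow> a" "\<not> x \<rightarrow> b" "\<not> x \<rightarrow> c" "x \<noteq> b" "x \<noteq> c"
    "hops s a = Suc (hops s x)"
proof -
  obtain x where x: "x \<in> verts G" "x \<rightarrow> a" "hops s a = Suc (hops s x)"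
    using predecessor[OF assms(1-3)] by blast
  show thesis
  proof (rule that[OF x(1,2) _ _ _ _ x(3)])
    show "\<not> x \<rightarrow> b" "\<not> x \<rightarrow> c"
      using hops_step[OF assms(1), of x b] hops_step[OF assms(1), of x c] x(3) assms(4,5)
      by linarith+
    show "x \<noteq> b" "x \<noteq> c" using x(3) assms(4,5) by auto
  qed
qed

text \<open>
  Each of the two sufficiency lemmas bounds the distance to one edge by the distance to the other.
  Their hypotheses are symmetric in \<open>a\<close> and \<open>b\<close>, which yields equality.
\<close>
lemma inner_centre_le:
  assumes "s \<in> verts G" "a \<in> verts G" "s \<noteq> a"
    and "\<And>x. x \<in> verts G \<Longrightarrow> non_mutual_neighbor G a b x \<Longrightarrow> x \<rightarrow> c"
  shows "min (hops s b) (hops s c) \<le> min (hops s a) (hops s c)"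
proof (rule ccontr)
  assume "\<not> ?thesis"
  then have "hops s a < hops s b" "hops s a < hops s c" by auto
  then obtain x where x: "x \<in> verts G" "x \<rightarrow> a" "\<not> x \<rightarrow> b" "\<not> x \<rightarrow> c"
    by (rule private_predecessor[OF assms(1-3)])
  then have "non_mutual_neighbor G a b x" unfolding non_mutual_neighbor_def by simp
  then show False using assms(4) x by blast
qed

lemma outer_centre_le:
  assumes V: "a \<in> verts G" "b \<in> verts G" "w \<in> verts G" "u \<in> verts G"
    and s: "s \<in> verts G - {a, b, w}"
    and near: "\<And>x. x \<in> verts G - {a, b, w} \<Longrightarrow> non_mutual_neighbor G a b x \<Longrightarrow> x \<noteq> u \<Longrightarrow> x \<rightarrow> u"
    and two: "\<And>x. x \<in> verts G - {a, b, w} \<Longrightarrow> hops x a = 2 \<Longrightarrow> 2 < hops x b \<Longrightarrow> hops x u \<le> 2"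
  shows "min (hops s b) (hops s u) \<le> min (hops s a) (hops s u)"
proof (rule ccontr)
  assume "\<not> ?thesis"
  then have lt: "hops s a < hops s b" "hops s a < hops s u" by auto
  have sV: "s \<in> verts G" "s \<noteq> a" "s \<noteq> w" using s by auto
  obtain x where x: "x \<in> verts G" "x \<rightarrow> a" "\<not> x \<rightarrow> b" "\<not> x \<rightarrow> u" "x \<noteq> b" "x \<noteq> u"
    "hops s a = Suc (hops s x)"
    by (rule private_predecessor[OF sV(1) V(1) sV(2) lt])
  have "x \<noteq> a" using x(2) adj_not_same by blast
  have "x = w"
  proof (rule ccontr)
    assume "x \<noteq> w"
    moreover have "non_mutual_neighbor G a b x"
      using x(2,3) unfolding non_mutual_neighbor_def by simp
    ultimately have "x \<rightarrow> u"
      using near[of x] x(1,5,6) \<open>x \<noteq> a\<close> by simp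
    with x(4) show False by blast
  qed
  \<comment> \<open>Since \<open>near\<close> is silent about \<open>w\<close>, the path to \<open>a\<close> is followed back by one more step.\<close>
  then obtain y where y: "y \<in> verts G" "y \<rightarrow> x" "hops s x = Suc (hops s y)"
    using predecessor[OF sV(1) V(3) sV(3)] by auto
  have far: "y \<noteq> a" "y \<noteq> b" "y \<noteq> x" using y x(7) lt by auto
  have "hops y a = 2"
  proof -
    have "hops y a \<le> 2"
      using hops_triangle[of y x a] hops_adj_le[of y x] hops_adj_le[of x a] x y V by simp
    moreover have "hops y a \<ge> 2"
      using hops_triangle[of s y a] x(7) y sV V by simp
    ultimately show ?thesis by simp
  qed
  moreover have "2 < hops y b"
    using hops_triangle[of s y b] x(7) y sV V lt by simp
  ultimately have "hops y u \<le> 2" using two[of y] y far \<open>x = w\<close> by blast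
  then show False using hops_triangle[of s y u] x(7) y sV V lt by simp
qed

text \<open>
  The vertices \<open>a\<close>, \<open>b\<close> and \<open>c\<close> themselves satisfy the right-hand condition because \<open>c\<close> is adjacent
  to the other two, so it matters only for vertices at which the two edges are compared.
\<close>
lemma inner_centre_iff:
  assumes V: "a \<in> verts G" "b \<in> verts G" "c \<in> verts G"
    and adj: "c \<rightarrow> a" "c \<rightarrow> b"
  shows "(\<forall>s \<in> verts G - {a, b, c}. edist G {a, c} s = edist G {b, c} s) \<longleftrightarrow>
    (\<forall>x \<in> verts G. non_mutual_neighbor G a b x \<longrightarrow> x \<rightarrow> c)" (is "?L \<longleftrightarrow> ?R")
proof
  assume L: ?L
  show ?R
  proof (intro ballI impI)
    fix x assume x: "x \<in> verts G" and nm: "non_mutual_neighbor G a b x"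
    show "x \<rightarrow> c"
    proof (cases "x \<in> {a, b, c}")
      case True
      then show ?thesis
        using nm adj adj_sym[of c a] adj_sym[of c b] adj_not_same
        unfolding non_mutual_neighbor_def by auto
    next
      case False
      then have "min (hops x a) (hops x c) = min (hops x b) (hops x c)"
        using L x V by (simp add: edist_pair)
      moreover have "hops x a = 1 \<longleftrightarrow> hops x b \<noteq> 1" "hops x a \<noteq> 0" "hops x b \<noteq> 0" "hops x c \<noteq> 0"
        using nm False x V hops_eq_1_iff[of x a] hops_eq_1_iff[of x b] hops_eq_0_iff[of x]
        unfolding non_mutual_neighbor_def by auto
      ultimately have "hops x c = 1" by linarith
      then show ?thesis using hops_eq_1_iff[of x c] x V False by blast
    qed
  qed
next
  assume R: ?R
  show ?L
  proof
    fix s assume s: "s \<in> verts G - {a, b, c}"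
    have "min (hops s b) (hops s c) \<le> min (hops s a) (hops s c)"
      using R s V by (intro inner_centre_le) auto
    moreover have "min (hops s a) (hops s c) \<le> min (hops s b) (hops s c)"
      using R s V by (intro inner_centre_le) (auto simp: non_mutual_neighbor_def)
    ultimately show "edist G {a, c} s = edist G {b, c} s"
      using s V by (simp add: edist_pair)
  qed
qed

lemma outer_centre_iff:
  assumes V: "a \<in> verts G" "b \<in> verts G" "w \<in> verts G" "u \<in> verts G"
  shows "(\<forall>s \<in> verts G - {a, b, w}. edist G {a, u} s = edist G {b, u} s) \<longleftrightarrow>
    (\<forall>x \<in> verts G - {a, b, w}. non_mutual_neighbor G a b x \<and> x \<noteq> u \<longrightarrow> x \<rightarrow> u) \<and>
    (\<forall>x \<in> verts G - {a, b, w}.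
       (vdist G x b > vdist G x a \<and> vdist G x a = 2) \<or>
       (vdist G x a > vdist G x b \<and> vdist G x b = 2) \<longrightarrow> vdist G x u \<le> 2)"
    (is "?L \<longleftrightarrow> ?N \<and> ?D")
proof -
  let ?D' = "\<forall>x \<in> verts G - {a, b, w}.
       (hops x b > hops x a \<and> hops x a = 2) \<or>
       (hops x a > hops x b \<and> hops x b = 2) \<longrightarrow> hops x u \<le> 2"
  have num: "ereal (real k) = 2 \<longleftrightarrow> k = 2" "ereal (real k) \<le> 2 \<longleftrightarrow> k \<le> 2" for k
    by simp_all
  have D: "?D \<longleftrightarrow> ?D'"
    using V by (intro ball_cong refl) (simp add: vdist_eq_hops num)
  have L: "?L \<longleftrightarrow> (\<forall>x \<in> verts G - {a, b, w}.
      min (hops x a) (hops x u) = min (hops x b) (hops x u))"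
    using V by (intro ball_cong refl) (simp add: edist_pair)
  have "?L \<longleftrightarrow> ?N \<and> ?D'"
    unfolding L
  proof (intro iffI conjI ballI impI)
    fix x
    assume eq: "\<forall>x \<in> verts G - {a, b, w}. min (hops x a) (hops x u) = min (hops x b) (hops x u)"
      and x: "x \<in> verts G - {a, b, w}"
    have m: "min (hops x a) (hops x u) = min (hops x b) (hops x u)" using eq x by blast
    {
      assume nm: "non_mutual_neighbor G a b x \<and> x \<noteq> u"
      have "hops x a = 1 \<longleftrightarrow> hops x b \<noteq> 1" "hops x a \<noteq> 0" "hops x b \<noteq> 0" "hops x u \<noteq> 0"
        using nm x V hops_eq_1_iff[of x a] hops_eq_1_iff[of x b] hops_eq_0_iff[of x]
        unfolding non_mutual_neighbor_def by auto
      with m have "hops x u = 1" by linarith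
      then show "x \<rightarrow> u" using hops_eq_1_iff[of x u] x V nm by blast
    next
      assume "(hops x b > hops x a \<and> hops x a = 2) \<or> (hops x a > hops x b \<and> hops x b = 2)"
      with m show "hops x u \<le> 2" by linarith
    }
  next
    fix s assume ND: "?N \<and> ?D'" and s: "s \<in> verts G - {a, b, w}"
    have "min (hops s b) (hops s u) \<le> min (hops s a) (hops s u)"
    proof (rule outer_centre_le[OF V s])
      show "x \<rightarrow> u" if "x \<in> verts G - {a, b, w}" "non_mutual_neighbor G a b x" "x \<noteq> u" for x
        using ND that by blast
      show "hops x u \<le> 2" if "x \<in> verts G - {a, b, w}" "hops x a = 2" "2 < hops x b" for x
        using ND that by simp
    qed
    moreover have "min (hops s a) (hops s u) \<le> min (hops s b) (hops s u)"
    proof (rule outer_centre_le[OF V(2,1,3,4)])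
      show "s \<in> verts G - {b, a, w}" using s by blast
      show "x \<rightarrow> u" if "x \<in> verts G - {b, a, w}" "non_mutual_neighbor G b a x" "x \<noteq> u" for x
        using ND that unfolding non_mutual_neighbor_def by blast
      show "hops x u \<le> 2" if "x \<in> verts G - {b, a, w}" "hops x b = 2" "2 < hops x a" for x
        using ND that by simp
    qed
    ultimately show "min (hops s a) (hops s u) = min (hops s b) (hops s u)" by simp
  qed
  then show ?thesis unfolding D .
qed

section \<open>Complements of triples\<close>

lemma edgeE:
  assumes "e \<in> edges G"
  obtains x y where "e = {x, y}" "x \<rightarrow> y" "x \<in> verts G" "y \<in> verts G" "x \<noteq> y"
proof -
  obtain x y where "e = {x, y}" "x \<rightarrow> y" using assms unfolding edges_def by auto
  then show thesis using that[of x y] adj_in_verts[of x y] adj_not_same by auto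
qed

lemma edge_subset_verts: "e \<in> edges G \<Longrightarrow> e \<subseteq> verts G"
  by (erule edgeE) simp

lemma card_edge: "e \<in> edges G \<Longrightarrow> card e = 2"
  by (erule edgeE) simp

lemma pair_mem_edges_iff: "{x, y} \<in> edges G \<longleftrightarrow> x \<rightarrow> y"
  unfolding edges_def by (auto simp: doubleton_eq_iff dest: adj_sym)

lemma edist_eq_0_iff:
  assumes "e \<in> edges G" "s \<in> verts G"
  shows "edist G e s = 0 \<longleftrightarrow> s \<in> e"
proof -
  obtain x y where "e = {x, y}" "x \<in> verts G" "y \<in> verts G" using assms(1) by (rule edgeE)
  then show ?thesis
    using edist_pair[of x y s] hops_eq_0_iff[of s x] hops_eq_0_iff[of s y] assms(2)
    by (auto simp: min_def)
qed

lemma edge_other_end: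
  assumes "e \<in> edges G" "c \<in> e"
  obtains a where "e = {a, c}" "c \<rightarrow> a" "a \<in> verts G" "c \<in> verts G" "a \<noteq> c"
  using assms(1)
proof (rule edgeE)
  fix x y assume "e = {x, y}" "x \<rightarrow> y" "x \<in> verts G" "y \<in> verts G" "x \<noteq> y"
  then show thesis
    using assms(2) that[of x] that[of y] adj_sym[of x y] by (auto simp: insert_commute)
qed

lemma not_edge_resolvingI:
  "\<lbrakk>e \<in> edges G; f \<in> edges G; e \<noteq> f; \<forall>s \<in> S. edist G e s = edist G f s\<rbrakk> \<Longrightarrow>
    \<not> edge_resolving G S"
  unfolding edge_resolving_def by blast

text \<open>
  The common vertex \<open>c\<close> exists because disjoint undistinguished edges would both lie inside \<open>T\<close>,
  where there is no room for two disjoint pairs.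
\<close>
lemma not_resolving_iff:
  assumes T: "T \<subseteq> verts G" "card T = 3"
  shows "\<not> edge_resolving G (verts G - T) \<longleftrightarrow>
    (\<exists>a \<in> T. \<exists>b \<in> T. \<exists>c \<in> verts G. a \<noteq> b \<and> c \<rightarrow> a \<and> c \<rightarrow> b \<and>
      (\<forall>s \<in> verts G - T. edist G {a, c} s = edist G {b, c} s))" (is "?L \<longleftrightarrow> ?R")
proof
  assume ?L
  then obtain e f where ef: "e \<in> edges G" "f \<in> edges G" "e \<noteq> f"
    and eq: "\<And>s. s \<in> verts G - T \<Longrightarrow> edist G e s = edist G f s"
    unfolding edge_resolving_def by blast
  have sub: "e \<subseteq> verts G" "f \<subseteq> verts G" and card: "card e = 2" "card f = 2"
    using ef(1,2) by (simp_all add: edge_subset_verts card_edge)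
  have outside: "s \<in> e \<longleftrightarrow> s \<in> f" if "s \<in> verts G - T" for s
    using edist_eq_0_iff[OF ef(1), of s] edist_eq_0_iff[OF ef(2), of s] eq[OF that] that by simp
  have "e \<inter> f \<noteq> {}"
  proof
    assume disj: "e \<inter> f = {}"
    then have "e \<union> f \<subseteq> T" using outside sub by blast
    then have "card (e \<union> f) \<le> 3"
      using card_mono[of T "e \<union> f"] finite_subset[OF T(1)] T(2) by simp
    moreover have "card (e \<union> f) = 4"
      using disj card card_Un_disjoint[of e f] card_ge_0_finite[of e] card_ge_0_finite[of f] by simp
    ultimately show False by simp
  qed
  then obtain c where c: "c \<in> e" "c \<in> f" by blast
  obtain a where a: "e = {a, c}" "c \<rightarrow> a" "a \<in> verts G" "c \<in> verts G" "a \<noteq> c"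
    using ef(1) c(1) by (rule edge_other_end)
  obtain b where b: "f = {b, c}" "c \<rightarrow> b" "b \<in> verts G" "b \<noteq> c"
    using ef(2) c(2) by (rule edge_other_end)
  have "a \<noteq> b" using ef(3) a(1) b(1) by blast
  have "a \<in> T" using outside[of a] a b(1) \<open>a \<noteq> b\<close> by auto
  moreover have "b \<in> T" using outside[of b] a(1) b \<open>a \<noteq> b\<close> by auto
  moreover have "\<forall>s \<in> verts G - T. edist G {a, c} s = edist G {b, c} s"
    using eq unfolding a(1) b(1) by blast
  ultimately show ?R using a(2,4) b(2) \<open>a \<noteq> b\<close> by blast
next
  assume ?R
  then obtain a b c where "a \<noteq> b" "c \<rightarrow> a" "c \<rightarrow> b"
    and eq: "\<forall>s \<in> verts G - T. edist G {a, c} s = edist G {b, c} s" by blast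
  have "{a, c} \<in> edges G" "{b, c} \<in> edges G"
    using adj_sym[OF \<open>c \<rightarrow> a\<close>] adj_sym[OF \<open>c \<rightarrow> b\<close>] by (simp_all add: pair_mem_edges_iff)
  moreover have "{a, c} \<noteq> {b, c}"
    using \<open>a \<noteq> b\<close> by (auto simp: doubleton_eq_iff)
  ultimately show ?L using eq by (intro not_edge_resolvingI)
qed

lemma edge_resolving_verts: "edge_resolving G (verts G)"
  unfolding edge_resolving_def
proof (intro conjI notI)
  assume "\<exists>e\<in>edges G. \<exists>f\<in>edges G. e \<noteq> f \<and> (\<forall>s\<in>verts G. edist G e s = edist G f s)"
  then obtain e f where ef: "e \<in> edges G" "f \<in> edges G" "e \<noteq> f"
    and eq: "\<forall>s\<in>verts G. edist G e s = edist G f s" by blast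
  have "s \<in> e \<longleftrightarrow> s \<in> f" if "s \<in> verts G" for s
    using edist_eq_0_iff[OF ef(1) that] edist_eq_0_iff[OF ef(2) that] eq that by simp
  moreover have "e \<subseteq> verts G" "f \<subseteq> verts G"
    using ef(1,2) by (simp_all add: edge_subset_verts)
  ultimately show False using ef(3) by blast
qed simp

lemma edge_resolving_mono:
  "edge_resolving G S \<Longrightarrow> S \<subseteq> S' \<Longrightarrow> S' \<subseteq> verts G \<Longrightarrow> edge_resolving G S'"
  unfolding edge_resolving_def by blast

text \<open>
  Enlarging a resolving set of size at most \<open>n - 3\<close> to exactly that size makes its complement a triple.
\<close>
lemma edim_ge_iff:
  "int (edim G) \<ge> int (card (verts G)) - 2 \<longleftrightarrow>
    (\<forall>T. T \<subseteq> verts G \<and> card T = 3 \<longrightarrow> \<not> edge_resolving G (verts G - T))" (is "?L \<longleftrightarrow> ?R")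
proof (intro iffI allI impI notI)
  fix T assume L: ?L and T: "T \<subseteq> verts G \<and> card T = 3" and res: "edge_resolving G (verts G - T)"
  have "edim G \<le> card (verts G - T)"
    unfolding edim_def using res by (intro Least_le) blast
  moreover have "card (verts G - T) = card (verts G) - 3"
    using T by (simp add: card_Diff_subset finite_subset[OF _ finite_verts])
  moreover have "3 \<le> card (verts G)"
    using T card_mono[OF finite_verts, of T] by simp
  ultimately show False using L by simp
next
  assume R: ?R
  show ?L
  proof (rule ccontr)
    assume "\<not> ?L"
    then have small: "edim G + 3 \<le> card (verts G)" by simp
    have "\<exists>S. edge_resolving G S \<and> card S = card (verts G)" using edge_resolving_verts by blast
    then have "\<exists>S. edge_resolving G S \<and> card S = edim G"
      unfolding edim_def by (rule LeastI)
    then obtain S where S: "edge_resolving G S" "card S = edim G" by blast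
    then have sub: "S \<subseteq> verts G" unfolding edge_resolving_def by blast
    then have "card (verts G - S) = card (verts G) - edim G"
      using S by (simp add: card_Diff_subset finite_subset[OF _ finite_verts])
    then have "3 \<le> card (verts G - S)" using small by simp
    then obtain T where T: "T \<subseteq> verts G - S" "card T = 3"
      by (rule obtain_subset_with_card_n)
    then have "edge_resolving G (verts G - T)"
      using sub by (intro edge_resolving_mono[OF S(1)]) auto
    then show False using R T by blast
  qed
qed

end

section \<open>The characterization\<close>

theorem theorem4p3:
  fixes G :: "('a, 'b) pre_digraph" and n :: nat
  assumes "graph G" and "Digraph_Component.connected G" and "card (verts G) = n"
  shows "int (edim G) \<ge> int n - 2 \<longleftrightarrow>
    (\<forall>T. T \<subseteq> verts G \<and> card T = 3 \<longrightarrow>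
      (\<exists>v1 v2 v3. T = {v1, v2, v3} \<and>
        ((v3 \<rightarrow>\<^bsub>G\<^esub> v1 \<and> v3 \<rightarrow>\<^bsub>G\<^esub> v2 \<and>
          (\<forall>x \<in> verts G. non_mutual_neighbor G v1 v2 x \<longrightarrow> x \<rightarrow>\<^bsub>G\<^esub> v3))
        \<or>
         (\<exists>u \<in> verts G - {v1, v2, v3}.
            u \<rightarrow>\<^bsub>G\<^esub> v1 \<and> u \<rightarrow>\<^bsub>G\<^esub> v2 \<and>
            (\<forall>x \<in> verts G - {v1, v2, v3}.
               non_mutual_neighbor G v1 v2 x \<and> x \<noteq> u \<longrightarrow> x \<rightarrow>\<^bsub>G\<^esub> u) \<and>
            (\<forall>x \<in> verts G - {v1, v2, v3}.
               (vdist G x v2 > vdist G x v1 \<and> vdist G x v1 = 2) \<or>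
               (vdist G x v1 > vdist G x v2 \<and> vdist G x v2 = 2) \<longrightarrow>
               vdist G x u \<le> 2)))))"
proof -
  interpret connected_graph G
    using assms(1,2) by (simp add: connected_graph_def connected_graph_axioms_def)
  define inner where "inner v1 v2 v3 \<longleftrightarrow>
      (\<forall>x \<in> verts G. non_mutual_neighbor G v1 v2 x \<longrightarrow> x \<rightarrow>\<^bsub>G\<^esub> v3)" for v1 v2 v3
  define outer where "outer v1 v2 v3 u \<longleftrightarrow>
      (\<forall>x \<in> verts G - {v1, v2, v3}.
         non_mutual_neighbor G v1 v2 x \<and> x \<noteq> u \<longrightarrow> x \<rightarrow>\<^bsub>G\<^esub> u) \<and>
      (\<forall>x \<in> verts G - {v1, v2, v3}.
         (vdist G x v2 > vdist G x v1 \<and> vdist G x v1 = 2) \<or>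
         (vdist G x v1 > vdist G x v2 \<and> vdist G x v2 = 2) \<longrightarrow>
         vdist G x u \<le> 2)" for v1 v2 v3 u
  have char: "\<not> edge_resolving G (verts G - T) \<longleftrightarrow>
      (\<exists>v1 v2 v3. T = {v1, v2, v3} \<and>
        (v3 \<rightarrow>\<^bsub>G\<^esub> v1 \<and> v3 \<rightarrow>\<^bsub>G\<^esub> v2 \<and> inner v1 v2 v3 \<or>
         (\<exists>u \<in> verts G - {v1, v2, v3}. u \<rightarrow>\<^bsub>G\<^esub> v1 \<and> u \<rightarrow>\<^bsub>G\<^esub> v2 \<and> outer v1 v2 v3 u)))"
    (is "?L \<longleftrightarrow> ?R") if T: "T \<subseteq> verts G" "card T = 3" for T
  proof
    assume ?L
    then obtain a b c where ab: "a \<in> T" "b \<in> T" "a \<noteq> b"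
      and c: "c \<in> verts G" "c \<rightarrow>\<^bsub>G\<^esub> a" "c \<rightarrow>\<^bsub>G\<^esub> b"
      and eq: "\<forall>s \<in> verts G - T. edist G {a, c} s = edist G {b, c} s"
      unfolding not_resolving_iff[OF T] by blast
    have "c \<noteq> a" "c \<noteq> b" using c adj_not_same by blast+
    have "card (T - {a, b}) = 1" using T(2) ab by (simp add: card_Diff_subset)
    then obtain w where "T - {a, b} = {w}" by (auto simp: card_1_singleton_iff)
    then have Tw: "T = {a, b, w}" using ab by blast
    have V: "a \<in> verts G" "b \<in> verts G" "w \<in> verts G" using T(1) Tw by auto
    show ?R
    proof (cases "c = w")
      case True
      then have "inner a b w"
        using inner_centre_iff[OF V] c eq Tw unfolding inner_def by simp
      then show ?thesis using Tw True c by blast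
    next
      case False
      have "outer a b w c"
        using outer_centre_iff[OF V c(1)] eq unfolding Tw outer_def by (rule iffD1)
      moreover have "c \<in> verts G - {a, b, w}"
        using False c \<open>c \<noteq> a\<close> \<open>c \<noteq> b\<close> by blast
      ultimately show ?thesis using Tw c by blast
    qed
  next
    assume ?R
    then obtain v1 v2 v3 where Tv: "T = {v1, v2, v3}"
      and alt: "v3 \<rightarrow>\<^bsub>G\<^esub> v1 \<and> v3 \<rightarrow>\<^bsub>G\<^esub> v2 \<and> inner v1 v2 v3 \<or>
        (\<exists>u \<in> verts G - {v1, v2, v3}. u \<rightarrow>\<^bsub>G\<^esub> v1 \<and> u \<rightarrow>\<^bsub>G\<^esub> v2 \<and> outer v1 v2 v3 u)"
      by blast
    have V: "v1 \<in> verts G" "v2 \<in> verts G" "v3 \<in> verts G" using T(1) Tv by auto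
    have "v1 \<noteq> v2"
    proof
      assume "v1 = v2"
      then have "card T \<le> 2" unfolding Tv by (simp add: card_insert_if)
      then show False using T(2) by simp
    qed
    from alt have "\<exists>c \<in> verts G. c \<rightarrow>\<^bsub>G\<^esub> v1 \<and> c \<rightarrow>\<^bsub>G\<^esub> v2 \<and>
        (\<forall>s \<in> verts G - T. edist G {v1, c} s = edist G {v2, c} s)"
    proof
      assume "v3 \<rightarrow>\<^bsub>G\<^esub> v1 \<and> v3 \<rightarrow>\<^bsub>G\<^esub> v2 \<and> inner v1 v2 v3"
      then show ?thesis
        using inner_centre_iff[OF V] V(3) unfolding Tv inner_def by blast
    next
      assume "\<exists>u \<in> verts G - {v1, v2, v3}. u \<rightarrow>\<^bsub>G\<^esub> v1 \<and> u \<rightarrow>\<^bsub>G\<^esub> v2 \<and> outer v1 v2 v3 u"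
      then obtain u where u: "u \<in> verts G" "u \<rightarrow>\<^bsub>G\<^esub> v1" "u \<rightarrow>\<^bsub>G\<^esub> v2" "outer v1 v2 v3 u"
        by blast
      have "\<forall>s \<in> verts G - T. edist G {v1, u} s = edist G {v2, u} s"
        using outer_centre_iff[OF V u(1)] u(4) unfolding Tv outer_def by (rule iffD2)
      then show ?thesis using u by blast
    qed
    then show ?L unfolding not_resolving_iff[OF T] using \<open>v1 \<noteq> v2\<close> Tv by blast
  qed
  show ?thesis
    unfolding edim_ge_iff[unfolded assms(3)] using char
    by (simp only: inner_def outer_def cong: imp_cong conj_cong)
qed

end
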